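(* For each $k\in\mathbb{N}$ let $G_k:=\langle \mathrm{Alt}(\mathbb{Z}), t^k\rangle\le \mathrm{Sym}(\mathbb{Z})$. Then: (i) for every $k\in\mathbb{N}$, the group $G_k$ is 2-generated; (ii) for every $k\in\mathbb{N}$, every proper quotient of $G_k$ is cyclic; but (iii) for every $k\in\{3,4,\ldots\}$, the group $G_k$ is not $\frac32$-generated, i.e. $s(G_k)=0$.
   Context: $\mathbb{N}=\{1,2,3,\ldots\}$. $\mathrm{Sym}(\mathbb{Z})$ is the group of all bijections of $\mathbb{Z}$, acting on the right (so products are composed left to right). For $g\in\mathrm{Sym}(\mathbb{Z})$, $\mathrm{supp}(g)=\{x\in\mathbb{Z}: (x)g\neq x\}$; $\mathrm{FSym}(\mathbb{Z})$ is the subgroup of $g$ with $\mathrm{supp}(g)$ finite, and $\mathrm{Alt}(\mathbb{Z})\le\mathrm{FSym}(\mathbb{Z})$ is the subgroup of even permutations. $t\in\mathrm{Sym}(\mathbb{Z})$ is the translation $z\mapsto z+1$. A group is 2-generated if it can be generated by two elements. A proper quotient of $G$ is a quotient $G/N$ with $N$ a non-trivial normal subgroup. A group $G$ is $\frac32$-generated if for every non-trivial $g\in G$ there is $h\in G$ with $\langle g,h\rangle=G$. The spread $s(G)$ is the supremum of those $k\in\mathbb{N}\cup\{0\}$ such that for every $g_1,\ldots,g_k\in G\setminus\{1\}$ there exists $h\in G$ with $\langle g_1,h\rangle=\cdots=\langle g_k,h\rangle=G$. *)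

theory Defs
  imports
    "HOL-Algebra.Elementary_Groups"
    "HOL-Combinatorics.Permutations"
    "HOL-Library.Extended_Nat"
begin

text \<open>Permutations act on the right, so the product of \<open>f\<close> and \<open>g\<close> is ``first \<open>f\<close>, then \<open>g\<close>''.\<close>

definition SymZ :: "(int \<Rightarrow> int) monoid" where
  "SymZ = \<lparr>carrier = {f. bij f}, monoid.mult = (\<lambda>f g. g \<circ> f), one = id\<rparr>"

definition supp :: "(int \<Rightarrow> int) \<Rightarrow> int set" where
  "supp g = {x. g x \<noteq> x}"

definition FSymZ :: "(int \<Rightarrow> int) set" where
  "FSymZ = {g \<in> carrier SymZ. finite (supp g)}"

text \<open>The library's \<^const>\<open>evenperm\<close> is only meaningful for permutations of finite support.\<close>

definition AltZ :: "(int \<Rightarrow> int) set" where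
  "AltZ = {g \<in> FSymZ. evenperm g}"

definition transl :: "int \<Rightarrow> int" where
  "transl z = z + 1"

definition Gk :: "nat \<Rightarrow> (int \<Rightarrow> int) monoid" where
  "Gk k = subgroup_generated SymZ (AltZ \<union> {transl [^]\<^bsub>SymZ\<^esub> k})"

definition two_generated :: "('a, 'b) monoid_scheme \<Rightarrow> bool" where
  "two_generated G \<longleftrightarrow> (\<exists>a\<in>carrier G. \<exists>b\<in>carrier G. generate G {a, b} = carrier G)"

definition three_halves_generated :: "('a, 'b) monoid_scheme \<Rightarrow> bool" where
  "three_halves_generated G \<longleftrightarrow>
     (\<forall>g\<in>carrier G - {\<one>\<^bsub>G\<^esub>}. \<exists>h\<in>carrier G. generate G {g, h} = carrier G)"

text \<open>The supremum is taken in the extended naturals, since the spread may be infinite.\<close>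

definition spread :: "('a, 'b) monoid_scheme \<Rightarrow> enat" where
  "spread G = Sup {enat k | k.
     \<forall>g \<in> {1..k} \<rightarrow> carrier G - {\<one>\<^bsub>G\<^esub>}.
       \<exists>h\<in>carrier G. \<forall>i\<in>{1..k}. generate G {g i, h} = carrier G}"

lemma group_SymZ: "group SymZ"
proof (rule groupI)
  fix f assume "f \<in> carrier SymZ"
  then have "bij (inv_into UNIV f)" and "f \<circ> inv_into UNIV f = id"
    by (auto simp: SymZ_def bij_imp_bij_inv bij_is_surj surj_iff[symmetric])
  then show "\<exists>g\<in>carrier SymZ. g \<otimes>\<^bsub>SymZ\<^esub> f = \<one>\<^bsub>SymZ\<^esub>"
    by (auto simp: SymZ_def)
qed (auto simp: SymZ_def bij_comp comp_assoc)

lemma transl_in_SymZ: "transl \<in> carrier SymZ"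
proof -
  have "bij transl"
    by (rule bij_betw_byWitness[where f' = "\<lambda>z. z - 1"]) (auto simp: transl_def)
  then show ?thesis
    by (simp add: SymZ_def)
qed

lemma AltZ_subset_SymZ: "AltZ \<subseteq> carrier SymZ"
  by (auto simp: AltZ_def FSymZ_def)

lemma group_Gk: "group (Gk k)"
  unfolding Gk_def by (rule group.group_subgroup_generated[OF group_SymZ])

lemma carrier_Gk: "carrier (Gk k) = generate SymZ (AltZ \<union> {transl [^]\<^bsub>SymZ\<^esub> k})"
proof -
  interpret group SymZ by (rule group_SymZ)
  have "AltZ \<union> {transl [^]\<^bsub>SymZ\<^esub> k} \<subseteq> carrier SymZ"
    using AltZ_subset_SymZ transl_in_SymZ by auto
  then show ?thesis
    unfolding Gk_def carrier_subgroup_generated by (simp add: Int_absorb1)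
qed

end

theory Submission
  imports Defs
begin

text \<open>The alternating group on an infinite set is generated by its three-cycles, which are all
  conjugate, and three-cycles arise as commutators of two permutations whose supports share exactly
  one point (\<open>commutator_single_overlap\<close>). The three claims follow from this.

  Two generators are the translation by \<open>k\<close> and the cycle on \<open>{0..2 * k}\<close>, which is even because its
  length is odd. The support of the cycle meets its translate by \<open>2 * k\<close> in the single point \<open>2 * k\<close>, so
  a commutator is a three-cycle of consecutive points, and its conjugates are all three-cycles of
  consecutive points. These generate the alternating group (\<open>AltZ_subset_if_consecutive_cyc3\<close>).

  A non-trivial normal subgroup contains a three-cycle, obtained from any of its non-identity elements
  by two commutations with three-cycles, and therefore the whole alternating group
  (\<open>AltZ_subset_if_nontrivial_normalized\<close>). A proper quotient is thus generated by the image of the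
  translation.

  For \<open>k \<ge> 3\<close> the three-cycle \<open>g\<close> on \<open>{0, 1, 2}\<close> is not part of a generating pair. Suppose that \<open>g\<close> and
  \<open>h\<close> generate. Then \<open>h\<close> is not finitary, so it agrees with a non-zero translation by a
  multiple of \<open>k\<close> outside a finite set and has at least three infinite orbits. By transitivity every orbit
  of \<open>h\<close> meets \<open>{0, 1, 2}\<close>; hence \<open>h\<close> has exactly three orbits, all infinite, each with one of the points
  \<open>0\<close>, \<open>1\<close>, \<open>2\<close>. So the images of \<open>{0, 1, 2}\<close> under the powers of \<open>h\<close> partition the integers, \<open>g\<close>
  fixes every block and \<open>h\<close> shifts the blocks. The alternating group does not preserve such a partition
  (\<open>cyc3_has_no_mate\<close>).\<close>

section \<open>Subgroups of the symmetric group, as sets of functions\<close>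

lemma inv_SymZ:
  assumes "bij f"
  shows "inv\<^bsub>SymZ\<^esub> f = inv_into UNIV f"
proof (rule group.inv_equality[OF group_SymZ])
  show "inv_into UNIV f \<otimes>\<^bsub>SymZ\<^esub> f = \<one>\<^bsub>SymZ\<^esub>"
    using assms by (simp add: SymZ_def bij_is_surj surj_iff[symmetric])
qed (use assms in \<open>auto simp: SymZ_def bij_imp_bij_inv\<close>)

lemma subgroup_SymZI:
  assumes "\<And>f. f \<in> H \<Longrightarrow> bij f" "id \<in> H"
    and "\<And>f g. f \<in> H \<Longrightarrow> g \<in> H \<Longrightarrow> f \<circ> g \<in> H"
    and "\<And>f. f \<in> H \<Longrightarrow> inv_into UNIV f \<in> H"
  shows "subgroup H SymZ"
proof (rule group.subgroupI[OF group_SymZ])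
  show "inv\<^bsub>SymZ\<^esub> f \<in> H" if "f \<in> H" for f
    using that assms by (simp add: inv_SymZ)
qed (use assms in \<open>auto simp: SymZ_def\<close>)

lemma subgroup_SymZ_bij: "subgroup H SymZ \<Longrightarrow> f \<in> H \<Longrightarrow> bij f"
  using subgroup.mem_carrier by (fastforce simp: SymZ_def)

lemma subgroup_SymZ_comp: "subgroup H SymZ \<Longrightarrow> f \<in> H \<Longrightarrow> g \<in> H \<Longrightarrow> f \<circ> g \<in> H"
  using subgroup.m_closed[of H SymZ g f] by (simp add: SymZ_def)

lemma subgroup_SymZ_inv: "subgroup H SymZ \<Longrightarrow> f \<in> H \<Longrightarrow> inv_into UNIV f \<in> H"
  using subgroup.m_inv_closed[of H SymZ f] by (simp add: inv_SymZ subgroup_SymZ_bij)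

lemma subgroup_SymZ_id: "subgroup H SymZ \<Longrightarrow> id \<in> H"
  using subgroup.one_closed[of H SymZ] by (simp add: SymZ_def)

lemma subgroup_relation_stabilizer:
  "subgroup {f. bij f \<and> (\<forall>x y. R (f x) (f y) \<longleftrightarrow> R x y)} SymZ"
proof (rule subgroup_SymZI)
  fix f assume "f \<in> {f. bij f \<and> (\<forall>x y. R (f x) (f y) \<longleftrightarrow> R x y)}"
  then have "bij f" and f: "\<And>x y. R (f x) (f y) \<longleftrightarrow> R x y" by auto
  have "R (inv_into UNIV f x) (inv_into UNIV f y) \<longleftrightarrow> R x y" for x y
    using f[of "inv_into UNIV f x" "inv_into UNIV f y"] \<open>bij f\<close>
    by (simp add: bij_is_surj surj_f_inv_f)
  then show "inv_into UNIV f \<in> {f. bij f \<and> (\<forall>x y. R (f x) (f y) \<longleftrightarrow> R x y)}"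
    using \<open>bij f\<close> by (simp add: bij_imp_bij_inv)
qed (auto simp: bij_comp)

lemma supp_inv:
  assumes "bij f"
  shows "supp (inv_into UNIV f) = supp f"
  using assms unfolding supp_def
  by (metis (no_types, lifting) bij_inv_eq_iff)

lemma supp_comp_subset: "supp (f \<circ> g) \<subseteq> supp f \<union> supp g"
  by (auto simp: supp_def)

lemma AltZ_iff: "f \<in> AltZ \<longleftrightarrow> permutation f \<and> evenperm f"
  by (auto simp: AltZ_def FSymZ_def SymZ_def supp_def permutation)

lemma subgroup_AltZ: "subgroup AltZ SymZ"
  by (rule subgroup_SymZI)
    (auto simp: AltZ_iff permutation_compose evenperm_comp permutation_inverse evenperm_inv
      permutation_bijective)

section \<open>Three-cycles\<close>

definition cyc3 :: "int \<Rightarrow> int \<Rightarrow> int \<Rightarrow> int \<Rightarrow> int" where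
  "cyc3 x y z = transpose x y \<circ> transpose y z"

lemma cyc3_apply:
  assumes "distinct [x, y, z]"
  shows "cyc3 x y z w = (if w = x then y else if w = y then z else if w = z then x else w)"
  using assms by (auto simp: cyc3_def transpose_def)

lemma bij_cyc3: "bij (cyc3 x y z)"
  by (simp add: cyc3_def bij_comp)

lemma cyc3_rotate: "distinct [x, y, z] \<Longrightarrow> cyc3 x y z = cyc3 y z x"
  by (rule ext) (auto simp: cyc3_apply)

lemma inv_cyc3: "inv_into UNIV (cyc3 x y z) = cyc3 z y x"
  by (simp add: cyc3_def o_inv_distrib transpose_commute)

lemma supp_cyc3: "distinct [x, y, z] \<Longrightarrow> supp (cyc3 x y z) = {x, y, z}"
  by (auto simp: supp_def cyc3_apply)

lemma cyc3_in_AltZ: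
  assumes "distinct [x, y, z]"
  shows "cyc3 x y z \<in> AltZ"
  using assms
  by (simp add: AltZ_iff cyc3_def permutation_compose permutation_swap_id evenperm_comp evenperm_swap)

lemma cyc3_conjugate:
  assumes "bij f"
  shows "f \<circ> cyc3 x y z \<circ> inv_into UNIV f = cyc3 (f x) (f y) (f z)"
proof
  have [simp]: "f (transpose a b w) = transpose (f a) (f b) (f w)" for a b w
    using assms by (auto simp: transpose_def bij_def inj_eq)
  show "(f \<circ> cyc3 x y z \<circ> inv_into UNIV f) w = cyc3 (f x) (f y) (f z) w" for w
    using assms by (simp add: cyc3_def bij_is_surj surj_f_inv_f)
qed

lemma subgroup_cyc3_conjugate:
  assumes "subgroup H SymZ" "f \<in> H" "cyc3 x y z \<in> H"
  shows "cyc3 (f x) (f y) (f z) \<in> H"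
proof -
  have "f \<circ> cyc3 x y z \<circ> inv_into UNIV f \<in> H"
    using assms by (intro subgroup_SymZ_comp subgroup_SymZ_inv)
  then show ?thesis
    using assms by (simp add: cyc3_conjugate subgroup_SymZ_bij)
qed

text \<open>A point moved by only one of the two permutations is carried along by the other one without
  any effect, so only the shared point \<open>x\<close> and its two images survive in the commutator. This is the
  source of all three-cycles below.\<close>

lemma commutator_single_overlap:
  assumes "bij f" "bij g" and ov: "supp f \<inter> supp g = {x}"
  shows "f \<circ> (g \<circ> inv_into UNIV f \<circ> inv_into UNIV g) = cyc3 x (f x) (g x)"
proof
  fix w
  let ?f' = "inv_into UNIV f" and ?g' = "inv_into UNIV g"
  have f: "f (?f' a) = a" "?f' (f a) = a" and g: "g (?g' a) = a" "?g' (g a) = a" for a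
    using assms by (simp_all add: bij_is_surj surj_f_inv_f bij_is_inj inv_f_f)
  have fg: "f a = a \<or> g a = a" if "a \<noteq> x" for a
    using ov that by (auto simp: supp_def)
  have x: "f x \<noteq> x" "g x \<noteq> x"
    using ov by (auto simp: supp_def)
  have gfx: "g (f x) = f x" and fgx: "f (g x) = g x"
    using fg[of "f x"] fg[of "g x"] x f(2) g(2) by metis+
  have dist: "distinct [x, f x, g x]"
    using x gfx g(2) by (metis distinct_length_2_or_more distinct_singleton)
  consider "w = x" | "w = f x" | "w = g x" | "w \<noteq> x" "w \<noteq> f x" "w \<noteq> g x" by blast
  then show "(f \<circ> (g \<circ> ?f' \<circ> ?g')) w = cyc3 x (f x) (g x) w"
  proof cases
    case 1
    have "f (?g' x) = ?g' x"
      using fg[of "?g' x"] g x by metis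
    then show ?thesis using 1 dist f g by (simp add: cyc3_apply) (metis f(2) g(1))
  next
    case 2
    then show ?thesis using dist f g gfx fgx
      by (simp add: cyc3_apply) (metis f(2) fgx g(2) gfx)
  next
    case 3
    have "g (?f' x) = ?f' x"
      using fg[of "?f' x"] f x by metis
    then show ?thesis using 3 dist f g by (simp add: cyc3_apply)
  next
    case 4
    have "f (g (?f' (?g' w))) = w"
      using fg[of "?g' w"] fg[of "?f' w"] fg[of w] 4 f g by metis
    then show ?thesis using 4 dist by (simp add: cyc3_apply)
  qed
qed

section \<open>Subgroups that contain the alternating group\<close>

text \<open>Transpositions with a common point multiply to the identity or to a three-cycle; between
  other ones the square of a transposition that meets both can be inserted.\<close>

lemma transpose_pair_in:
  assumes H: "subgroup H SymZ" and c: "\<And>x y z. distinct [x, y, z] \<Longrightarrow> cyc3 x y z \<in> H"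
    and "a \<noteq> b" "c \<noteq> d"
  shows "transpose a b \<circ> transpose c d \<in> H"
proof -
  have meet: "transpose u v \<circ> transpose v w \<in> H" if "u \<noteq> v" "v \<noteq> w" for u v w
  proof (cases "u = w")
    case True
    then have "transpose u v \<circ> transpose v w = id" by (simp add: transpose_commute[of v])
    then show ?thesis using subgroup_SymZ_id[OF H] by metis
  next
    case False
    then show ?thesis using c[of u v w] that by (simp add: cyc3_def)
  qed
  consider "b = c" | "b = d" | "b \<noteq> c" "b \<noteq> d" by blast
  then show ?thesis
  proof cases
    case 3
    have "transpose a b \<circ> transpose c d
        = (transpose a b \<circ> transpose b c) \<circ> (transpose b c \<circ> transpose c d)"
      by (simp add: fun_eq_iff)
    then show ?thesis
      using meet[of a b c] meet[of b c d] 3 assms subgroup_SymZ_comp[OF H] by metis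
  qed (use meet[of a b c] meet[of a b d] meet[of a b "c"] assms in
      \<open>auto simp: transpose_commute[of c d]\<close>)
qed

lemma AltZ_subset_if_cyc3:
  assumes H: "subgroup H SymZ" and c: "\<And>x y z. distinct [x, y, z] \<Longrightarrow> cyc3 x y z \<in> H"
  shows "AltZ \<subseteq> H"
proof
  fix f assume "f \<in> AltZ"
  then obtain n where n: "swapidseq n f" and "even n"
    using evenperm_unique by (auto simp: AltZ_iff permutation_def)
  \<comment> \<open>An odd permutation is tracked through its products with an arbitrary transposition.\<close>
  have "(even n \<longrightarrow> f \<in> H) \<and> (odd n \<longrightarrow> (\<forall>a b. a \<noteq> b \<longrightarrow> transpose a b \<circ> f \<in> H))"
    using n
  proof (induction rule: swapidseq.induct)
    case id
    then show ?case using subgroup_SymZ_id[OF H] by (simp add: id_def)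
  next
    case (comp_Suc n p c d)
    have "transpose a b \<circ> (transpose c d \<circ> p) \<in> H" if "p \<in> H" "a \<noteq> b" for a b
      using subgroup_SymZ_comp[OF H transpose_pair_in[OF H c that(2) comp_Suc(2)] that(1)]
      by (simp add: comp_assoc)
    then show ?case using comp_Suc unfolding even_Suc by blast
  qed
  then show "f \<in> H" using \<open>even n\<close> by blast
qed

text \<open>Conjugating by a three-cycle of consecutive points moves one entry one step further. In this
  way the largest entry is moved first, and then the middle one.\<close>

lemma AltZ_subset_if_consecutive_cyc3:
  assumes H: "subgroup H SymZ" and c: "\<And>x. cyc3 x (x + 1) (x + 2) \<in> H"
  shows "AltZ \<subseteq> H"
proof -
  have far: "cyc3 x (x + 1) (x + 2 + int n) \<in> H" for x n
  proof (induction n)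
    case 0
    then show ?case using c[of x] by simp
  next
    case (Suc n)
    let ?z = "x + 2 + int n"
    have "cyc3 ?z (?z + 1) (?z + 2) x = x" "cyc3 ?z (?z + 1) (?z + 2) (x + 1) = x + 1"
      "cyc3 ?z (?z + 1) (?z + 2) ?z = x + 2 + int (Suc n)"
      by (simp_all add: cyc3_apply)
    then show ?case
      using subgroup_cyc3_conjugate[OF H c[of ?z] Suc.IH] by simp
  qed
  have mid: "cyc3 x (x + 1 + int n) z \<in> H" if "x + 1 + int n < z" for x z n
    using that
  proof (induction n)
    case 0
    then show ?case using far[of x "nat (z - x - 2)"] by simp
  next
    case (Suc n)
    let ?y = "x + 1 + int n"
    have "cyc3 ?y (?y + 1) (z + 1) \<in> H"
      using far[of ?y "nat (z - ?y - 1)"] Suc.prems by (simp add: add.commute[of 1])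
    moreover have "cyc3 x ?y z \<in> H" using Suc by simp
    moreover have "cyc3 ?y (?y + 1) (z + 1) x = x" "cyc3 ?y (?y + 1) (z + 1) z = z"
      "cyc3 ?y (?y + 1) (z + 1) ?y = x + 1 + int (Suc n)"
      using Suc.prems by (simp_all add: cyc3_apply)
    ultimately show ?case
      using subgroup_cyc3_conjugate[OF H] by metis
  qed
  have ord: "cyc3 x y z \<in> H" if "x < y" "y < z" for x y z
    using mid[of x "nat (y - x - 1)" z] that by simp
  have rev: "cyc3 z y x \<in> H" if "x < y" "y < z" for x y z
    using subgroup_SymZ_inv[OF H ord[OF that]] by (simp add: inv_cyc3)
  have "cyc3 x y z \<in> H" if d: "distinct [x, y, z]" for x y z
  proof -
    have r: "cyc3 x y z = cyc3 y z x" "cyc3 x y z = cyc3 z x y"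
      using cyc3_rotate[of x y z] cyc3_rotate[of y z x] d by auto
    consider "x < y" "y < z" | "y < z" "z < x" | "z < x" "x < y"
      | "z < y" "y < x" | "x < z" "z < y" | "y < x" "x < z"
      using d by fastforce
    then show ?thesis by cases (use ord rev r in metis)+
  qed
  then show ?thesis by (rule AltZ_subset_if_cyc3[OF H])
qed

lemma fresh_int: "finite F \<Longrightarrow> \<exists>u::int. u \<notin> F"
  using ex_new_if_finite infinite_UNIV_int by blast

text \<open>Infinitely many points are available, so any two three-cycles are linked by changing one
  entry at a time, and a change of one entry is a conjugation by a three-cycle that involves a point
  outside everything else.\<close>

lemma AltZ_subset_if_normalized:
  assumes H: "subgroup H SymZ"
    and conj: "\<And>f g. f \<in> H \<Longrightarrow> g \<in> AltZ \<Longrightarrow> g \<circ> f \<circ> inv_into UNIV g \<in> H"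
    and xyz: "cyc3 x y z \<in> H" "distinct [x, y, z]"
  shows "AltZ \<subseteq> H"
proof (rule AltZ_subset_if_cyc3[OF H])
  have last: "cyc3 a b d \<in> H" if abc: "cyc3 a b c \<in> H" "distinct [a, b, c]" "distinct [a, b, d]"
    for a b c d
  proof (cases "c = d")
    case False
    obtain w where w: "w \<notin> {a, b, c, d}" using fresh_int[of "{a, b, c, d}"] by auto
    have d: "distinct [c, d, w]" using False w by auto
    show ?thesis
      using conj[OF abc(1) cyc3_in_AltZ[OF d]] abc(2,3) w
      by (simp add: cyc3_conjugate bij_cyc3) (simp add: cyc3_apply[OF d] split: if_splits)
  qed (use that in simp)
  have rot: "cyc3 b c a \<in> H" if "cyc3 a b c \<in> H" "distinct [a, b, c]" for a b c
    using that cyc3_rotate[OF that(2)] by simp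
  fix u v w :: int assume uvw: "distinct [u, v, w]"
  obtain p where p: "p \<notin> {x, y, z, u, v, w}" using fresh_int[of "{x, y, z, u, v, w}"] by auto
  obtain q where q: "q \<notin> {x, y, z, u, v, w, p}" using fresh_int[of "{x, y, z, u, v, w, p}"] by auto
  have "cyc3 x y p \<in> H" using last[OF xyz] p xyz by auto
  then have "cyc3 p x y \<in> H" using rot[of x y p] rot[of y p x] p xyz by auto
  then have "cyc3 p x q \<in> H" using last[of p x y q] p q xyz by auto
  then have "cyc3 q p x \<in> H" using rot[of p x q] rot[of x q p] p q by auto
  then have "cyc3 q p u \<in> H" using last[of q p x u] p q by auto
  then have "cyc3 p u q \<in> H" using rot[of q p u] p q by auto
  then have "cyc3 p u v \<in> H" using last[of p u q v] p q uvw by auto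
  then have "cyc3 u v p \<in> H" using rot[of p u v] p uvw by auto
  then show "cyc3 u v w \<in> H" using last[of u v p w] p uvw by auto
qed

text \<open>Commutation with three-cycles turns an arbitrary non-identity element of \<open>H\<close> into a
  three-cycle. The first commutator is a product of two three-cycles and so has finite support; now
  there are fixed points, and a second commutator, with a three-cycle that meets the support in a
  single point, is a three-cycle.\<close>

lemma AltZ_subset_if_nontrivial_normalized:
  assumes H: "subgroup H SymZ"
    and conj: "\<And>f g. f \<in> H \<Longrightarrow> g \<in> AltZ \<Longrightarrow> g \<circ> f \<circ> inv_into UNIV g \<in> H"
    and g: "g \<in> H" "g \<noteq> id"
  shows "AltZ \<subseteq> H"
proof -
  have comm: "f \<circ> (c \<circ> inv_into UNIV f \<circ> inv_into UNIV c) \<in> H" if "f \<in> H" "c \<in> AltZ" for f c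
    using that by (intro subgroup_SymZ_comp[OF H] conj subgroup_SymZ_inv[OF H])
  have "bij g" using g H subgroup_SymZ_bij by blast
  obtain x where x: "g x \<noteq> x" using g by fastforce
  obtain u where u: "u \<notin> {x, g x}" using fresh_int[of "{x, g x}"] by auto
  obtain v where v: "v \<notin> {x, g x, u}" using fresh_int[of "{x, g x, u}"] by auto
  have d: "distinct [x, u, v]" using u v by auto
  define p where "p = g \<circ> (cyc3 x u v \<circ> inv_into UNIV g \<circ> inv_into UNIV (cyc3 x u v))"
  have "p \<in> H" unfolding p_def using g cyc3_in_AltZ[OF d] by (rule_tac comm)
  have p_eq: "p = cyc3 (g x) (g u) (g v) \<circ> cyc3 v u x"
    unfolding p_def using cyc3_conjugate[OF \<open>bij g\<close>, of x u v] by (simp add: inv_cyc3 comp_assoc[symmetric])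
  have gd: "distinct [g x, g u, g v]"
    using d \<open>bij g\<close> by (auto simp: bij_def inj_eq)
  have p_moves: "p (g x) \<noteq> g x"
    using gd d x u v by (auto simp: p_eq cyc3_apply)
  have "supp p \<subseteq> {g x, g u, g v} \<union> {v, u, x}"
    using supp_comp_subset[of "cyc3 (g x) (g u) (g v)" "cyc3 v u x"] supp_cyc3[OF gd]
      supp_cyc3[of v u x] d p_eq by auto
  then have fin: "finite (supp p)" by (rule finite_subset) auto
  let ?y = "g x"
  obtain a where a: "a \<notin> supp p \<union> {?y}" using fresh_int[of "supp p \<union> {?y}"] fin by auto
  obtain b where b: "b \<notin> supp p \<union> {?y, a}" using fresh_int[of "supp p \<union> {?y, a}"] fin by auto
  have d': "distinct [?y, a, b]" using a b by auto
  have "supp p \<inter> supp (cyc3 ?y a b) = {?y}"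
    using a b p_moves unfolding supp_cyc3[OF d'] by (auto simp: supp_def)
  then have "cyc3 ?y (p ?y) (cyc3 ?y a b ?y) \<in> H"
    using commutator_single_overlap[of p "cyc3 ?y a b" ?y] comm[OF \<open>p \<in> H\<close> cyc3_in_AltZ[OF d']]
      subgroup_SymZ_bij[OF H \<open>p \<in> H\<close>] bij_cyc3 by auto
  then have c: "cyc3 ?y (p ?y) a \<in> H" using d' by (simp add: cyc3_apply)
  have "p a = a" using a by (auto simp: supp_def)
  then have "p ?y \<noteq> a"
    using d' subgroup_SymZ_bij[OF H \<open>p \<in> H\<close>] by (metis bij_is_inj distinct_length_2_or_more inj_eq)
  then show ?thesis
    using AltZ_subset_if_normalized[OF H conj c] p_moves d' by auto
qed

text \<open>A form of two-transitivity of the alternating group. It serves twice, for the relation of lying on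
  the same side of a set and for the relation of lying in the same block.\<close>

lemma relation_spreads_if_AltZ_preserves:
  assumes R: "\<And>f x y. f \<in> AltZ \<Longrightarrow> R (f x) (f y) \<longleftrightarrow> R x y"
    and "R a b" "a \<noteq> b" "c \<noteq> b"
  shows "R c b"
proof (cases "c = a")
  case False
  obtain w where w: "w \<notin> {a, b, c}" using fresh_int[of "{a, b, c}"] by auto
  then have d: "distinct [a, c, w]" using False by auto
  show ?thesis
    using R[OF cyc3_in_AltZ[OF d], of a b] assms w d by (auto simp: cyc3_apply)
qed (use assms in simp)

section \<open>The groups generated by the alternating group and a translation\<close>

lemma transl_pow: "transl [^]\<^bsub>SymZ\<^esub> (k::nat) = (\<lambda>x. x + int k)"
proof (induction k)
  case 0
  then show ?case by (simp add: nat_pow_def SymZ_def id_def)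
next
  case (Suc k)
  then show ?case
    by (simp add: monoid.nat_pow_Suc[OF group.is_monoid[OF group_SymZ]])
      (auto simp: SymZ_def transl_def)
qed

lemma Gk_generators_subset: "AltZ \<union> {transl [^]\<^bsub>SymZ\<^esub> (k::nat)} \<subseteq> carrier SymZ"
proof -
  interpret group SymZ by (rule group_SymZ)
  show ?thesis using AltZ_subset_SymZ transl_in_SymZ by auto
qed

lemma subgroup_Gk: "subgroup (carrier (Gk k)) SymZ"
  unfolding carrier_Gk by (rule group.generate_is_subgroup[OF group_SymZ Gk_generators_subset])

lemma Gk_eq: "Gk k = SymZ\<lparr>carrier := carrier (Gk k)\<rparr>"
  by (simp add: Gk_def subgroup_generated_def)

lemma AltZ_subset_Gk: "AltZ \<subseteq> carrier (Gk k)"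
  unfolding carrier_Gk by (auto intro: generate.incl)

lemma transl_in_Gk: "(\<lambda>x. x + int k) \<in> carrier (Gk k)"
  unfolding carrier_Gk transl_pow[symmetric] by (auto intro: generate.incl)

lemma carrier_Gk_subset:
  assumes "subgroup H SymZ" "AltZ \<subseteq> H" "(\<lambda>x. x + int k) \<in> H"
  shows "carrier (Gk k) \<subseteq> H"
  unfolding carrier_Gk
  using assms by (intro group.generate_subgroup_incl[OF group_SymZ]) (auto simp: transl_pow)

lemma generate_Gk: "S \<subseteq> carrier (Gk k) \<Longrightarrow> generate (Gk k) S = generate SymZ S"
  by (rule group.generate_consistent[OF group_SymZ _ subgroup_Gk, folded Gk_eq])

lemma one_Gk: "\<one>\<^bsub>Gk k\<^esub> = id"
  by (subst Gk_eq) (simp add: SymZ_def)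

section \<open>Two generators\<close>

definition long_cycle :: "nat \<Rightarrow> int \<Rightarrow> int" where
  "long_cycle n x = (if 0 \<le> x \<and> x < 2 * int n then x + 1 else if x = 2 * int n then 0 else x)"

text \<open>Multiplication by a three-cycle that shares one point with a cycle lengthens the cycle by two.\<close>

lemma long_cycle_in_AltZ: "long_cycle n \<in> AltZ"
proof (induction n)
  case 0
  have "long_cycle 0 = id" by (auto simp: long_cycle_def)
  then show ?case using subgroup_SymZ_id[OF subgroup_AltZ] by (metis)
next
  case (Suc n)
  let ?c = "cyc3 (2 * int n) (2 * int n + 1) (2 * int n + 2)"
  have "?c \<in> AltZ" by (rule cyc3_in_AltZ) simp
  then have "long_cycle n \<circ> ?c \<in> AltZ" using Suc by (rule_tac subgroup_SymZ_comp[OF subgroup_AltZ])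
  moreover have "long_cycle (Suc n) = long_cycle n \<circ> ?c"
    by (rule ext) (auto simp: long_cycle_def cyc3_apply)
  ultimately show ?case by metis
qed

lemma supp_long_cycle: "n \<ge> 1 \<Longrightarrow> supp (long_cycle n) = {0..2 * int n}"
  by (auto simp: supp_def long_cycle_def)

text \<open>The support \<open>{0..2 * k}\<close> of the long cycle meets its translate by \<open>2 * k\<close> in one point only, so
  their commutator gives a three-cycle of consecutive points. Conjugation by the long cycle moves it
  through \<open>k\<close> successive positions, one in each residue class, and the translation does the rest.\<close>

lemma Gk_eq_generate:
  assumes "k \<ge> 1"
  shows "generate SymZ {long_cycle k, \<lambda>x. x + int k} = carrier (Gk k)" (is "?H = _")
proof
  let ?a = "long_cycle k" and ?s = "\<lambda>x. x + int k"
  have gens: "{?a, ?s} \<subseteq> carrier (Gk k)"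
    using long_cycle_in_AltZ AltZ_subset_Gk transl_in_Gk by blast
  then show "?H \<subseteq> carrier (Gk k)"
    by (rule group.generate_subgroup_incl[OF group_SymZ _ subgroup_Gk])
  have H: "subgroup ?H SymZ"
    using group.generate_is_subgroup[OF group_SymZ] gens subgroup.subset[OF subgroup_Gk] by blast
  have a: "?a \<in> ?H" and s: "?s \<in> ?H" by (auto intro: generate.incl)
  note ba = subgroup_SymZ_bij[OF H a]
  have s_inv: "inv_into UNIV ?s = (\<lambda>x. x - int k)"
    by (rule inv_unique_comp) auto
  have s': "(\<lambda>x. x - int k) \<in> ?H"
    using subgroup_SymZ_inv[OF H s] s_inv by simp
  define b where "b = ?s \<circ> ?s \<circ> ?a \<circ> (\<lambda>x. x - int k) \<circ> (\<lambda>x. x - int k)"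
  have b: "b \<in> ?H"
    unfolding b_def by (intro subgroup_SymZ_comp[OF H] a s s')
  have b_apply: "b x = ?a (x - 2 * int k) + 2 * int k" for x
    by (simp add: b_def algebra_simps)
  let ?x = "2 * int k"
  let ?a' = "inv_into UNIV ?a"
  have sb: "supp b = {?x..2 * ?x}"
    using assms by (auto simp: supp_def b_apply long_cycle_def)
  have sa: "supp ?a' = {0..?x}"
    using supp_inv[OF ba] supp_long_cycle[OF assms] by simp
  have a'x: "?a' ?x = ?x - 1"
    using assms by (intro inv_f_eq bij_is_inj[OF ba]) (simp add: long_cycle_def)
  have bx: "b ?x = ?x + 1"
    using assms by (simp add: b_apply long_cycle_def)
  have "supp b \<inter> supp ?a' = {?x}"
    unfolding sa sb by auto
  from commutator_single_overlap[OF subgroup_SymZ_bij[OF H b] bij_imp_bij_inv[OF ba] this]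
  have "cyc3 ?x (?x + 1) (?x - 1)
      = b \<circ> (?a' \<circ> inv_into UNIV b \<circ> inv_into UNIV ?a')"
    by (simp add: a'x bx)
  moreover have "\<dots> \<in> ?H"
    by (intro subgroup_SymZ_comp[OF H] subgroup_SymZ_inv[OF H] a b)
  ultimately have c0: "cyc3 (?x - 1) ?x (?x + 1) \<in> ?H"
    using cyc3_rotate[of "?x - 1" ?x "?x + 1"] by simp
  have c1: "cyc3 (int k - 1 + int j) (int k + int j) (int k + 1 + int j) \<in> ?H" if "j < k" for j
    using that
  proof (induction j)
    case 0
    show ?case using subgroup_cyc3_conjugate[OF H s' c0] by (simp add: algebra_simps)
  next
    case (Suc j)
    then have "cyc3 (int k - 1 + int j) (int k + int j) (int k + 1 + int j) \<in> ?H" by simp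
    moreover have "?a (int k - 1 + int j) = int k - 1 + int (Suc j)"
      "?a (int k + int j) = int k + int (Suc j)"
      "?a (int k + 1 + int j) = int k + 1 + int (Suc j)"
      using Suc.prems by (simp_all add: long_cycle_def)
    ultimately show ?case
      using subgroup_cyc3_conjugate[OF H a] by metis
  qed
  have up: "cyc3 x (x + 1) (x + 2) \<in> ?H \<longleftrightarrow> cyc3 (x + k) (x + k + 1) (x + k + 2) \<in> ?H" for x
    using subgroup_cyc3_conjugate[OF H s, of x "x + 1" "x + 2"]
      subgroup_cyc3_conjugate[OF H s', of "x + k" "x + k + 1" "x + k + 2"]
    by (auto simp: algebra_simps)
  have shift: "cyc3 x (x + 1) (x + 2) \<in> ?H
      \<longleftrightarrow> cyc3 (x + k * q) (x + k * q + 1) (x + k * q + 2) \<in> ?H" for x and q :: int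
  proof (induction q rule: int_induct[where k = 0])
    case (step1 q)
    then show ?case using up[of "x + k * q"] by (simp add: algebra_simps)
  next
    case (step2 q)
    then show ?case using up[of "x + k * (q - 1)"] by (simp add: algebra_simps)
  qed simp
  have "cyc3 y (y + 1) (y + 2) \<in> ?H" for y
  proof -
    let ?r = "(y - (int k - 1)) mod int k" and ?q = "(y - (int k - 1)) div int k"
    have "int k * ?q + ?r = y - (int k - 1)" by simp
    then have y: "y = int k - 1 + ?r + int k * ?q" by linarith
    have r: "0 \<le> ?r" "?r < int k" using assms by auto
    have "cyc3 (int k - 1 + ?r) (int k - 1 + ?r + 1) (int k - 1 + ?r + 2) \<in> ?H"
      using c1[of "nat ?r"] r by (simp add: nat_less_iff algebra_simps)
    then show ?thesis using shift[of "int k - 1 + ?r" ?q] y by simp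
  qed
  then have "AltZ \<subseteq> ?H" by (rule AltZ_subset_if_consecutive_cyc3[OF H])
  then show "carrier (Gk k) \<subseteq> ?H" using s by (rule carrier_Gk_subset[OF H])
qed

lemma two_generated_Gk:
  assumes "k \<ge> 1"
  shows "two_generated (Gk k)"
proof -
  have "long_cycle k \<in> carrier (Gk k)"
    using long_cycle_in_AltZ AltZ_subset_Gk by blast
  then show ?thesis
    unfolding two_generated_def
    using Gk_eq_generate[OF assms] generate_Gk[of "{long_cycle k, \<lambda>x. x + int k}" k] transl_in_Gk
    by (metis empty_subsetI insert_subset)
qed

section \<open>Proper quotients\<close>

lemma AltZ_subset_normal_subgroup:
  assumes N: "N \<lhd> Gk k" "N \<noteq> {\<one>\<^bsub>Gk k\<^esub>}"
  shows "AltZ \<subseteq> N"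
proof -
  interpret N: normal N "Gk k" by (rule N)
  have H: "subgroup N SymZ"
    by (rule group.incl_subgroup[OF group_SymZ subgroup_Gk, folded Gk_eq, OF N.subgroup_axioms])
  obtain g where g: "g \<in> N" "g \<noteq> id"
  proof -
    have "id \<in> N" using subgroup.one_closed[OF N.subgroup_axioms] by (simp only: one_Gk)
    then show thesis using N(2) that by (auto simp only: one_Gk)
  qed
  show ?thesis
  proof (rule AltZ_subset_if_nontrivial_normalized[OF H _ g])
    fix f c assume f: "f \<in> N" and "c \<in> AltZ"
    then have c: "c \<in> carrier (Gk k)" using AltZ_subset_Gk by blast
    have "bij c" using c subgroup_SymZ_bij[OF subgroup_Gk] by blast
    have "inv\<^bsub>Gk k\<^esub> c = inv_into UNIV c"
      using group.m_inv_consistent[OF group_SymZ subgroup_Gk c, folded Gk_eq] inv_SymZ[OF \<open>bij c\<close>]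
      by simp
    moreover have "u \<otimes>\<^bsub>Gk k\<^esub> v = v \<circ> u" for u v
      by (subst Gk_eq) (simp add: SymZ_def)
    ultimately show "c \<circ> f \<circ> inv_into UNIV c \<in> N"
      using N.inv_op_closed1[OF c f] by (simp add: comp_assoc)
  qed
qed

text \<open>The alternating group vanishes in the quotient, so the image of the translation generates.\<close>

lemma cyclic_quotient_Gk:
  assumes N: "N \<lhd> Gk k" "N \<noteq> {\<one>\<^bsub>Gk k\<^esub>}"
  shows "cyclic_group (Gk k Mod N)"
proof -
  interpret N: normal N "Gk k" by (rule N)
  let ?Q = "Gk k Mod N" and ?\<pi> = "\<lambda>x. N #>\<^bsub>Gk k\<^esub> x" and ?t = "transl [^]\<^bsub>SymZ\<^esub> k"
  interpret Q: group ?Q by (rule N.factorgroup_is_group)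
  interpret h: group_hom "Gk k" ?Q ?\<pi>
    by unfold_locales (rule N.r_coset_hom_Mod)
  have gens: "AltZ \<union> {?t} \<subseteq> carrier (Gk k)"
    using AltZ_subset_Gk transl_in_Gk by (simp add: transl_pow)
  have t: "?\<pi> ?t \<in> carrier ?Q" using gens by (intro h.hom_closed) simp
  have "?\<pi> c = \<one>\<^bsub>?Q\<^esub>" if "c \<in> AltZ" for c
    using that AltZ_subset_normal_subgroup[OF N] N.rcos_const[OF N.is_group] by auto
  then have img: "?\<pi> ` (AltZ \<union> {?t}) \<subseteq> generate ?Q {?\<pi> ?t}"
    using generate.one[of ?Q] generate.incl[of _ "{?\<pi> ?t}" ?Q] by fastforce
  have "carrier ?Q = ?\<pi> ` generate (Gk k) (AltZ \<union> {?t})"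
    using generate_Gk[OF gens] by (simp add: carrier_FactGroup carrier_Gk)
  also have "\<dots> = generate ?Q (?\<pi> ` (AltZ \<union> {?t}))"
    by (rule h.generate_img[OF gens, symmetric])
  also have "\<dots> \<subseteq> generate ?Q {?\<pi> ?t}"
    using img t by (intro Q.generate_subgroup_incl Q.generate_is_subgroup) auto
  finally have "carrier ?Q = generate ?Q {?\<pi> ?t}"
    using Q.generate_incl[of "{?\<pi> ?t}"] t by auto
  then have "subgroup_generated ?Q {?\<pi> ?t} = ?Q"
    using t by (simp add: subgroup_generated_def)
  then show ?thesis unfolding cyclic_group_def using t by (rule bexI)
qed

section \<open>An element without a mate\<close>

text \<open>The case \<open>k = 0\<close> gives the finitary permutations.\<close>

definition eventual_translations :: "nat \<Rightarrow> (int \<Rightarrow> int) set" where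
  "eventual_translations k = {f. bij f \<and> (\<exists>n::int. finite {x. f x \<noteq> x + int k * n})}"

lemma subgroup_eventual_translations: "subgroup (eventual_translations k) SymZ"
proof (rule subgroup_SymZI)
  show "id \<in> eventual_translations k"
    by (auto simp: eventual_translations_def intro!: exI[of _ 0])
next
  fix f g assume "f \<in> eventual_translations k" "g \<in> eventual_translations k"
  then obtain m n where f: "bij f" "finite {x. f x \<noteq> x + int k * m}"
    and g: "bij g" "finite {x. g x \<noteq> x + int k * n}"
    by (auto simp: eventual_translations_def)
  have "{x. (f \<circ> g) x \<noteq> x + int k * (m + n)}
      \<subseteq> {x. g x \<noteq> x + int k * n} \<union> g -` {x. f x \<noteq> x + int k * m}"
    by (auto simp: distrib_left)
  moreover have "finite (g -` {x. f x \<noteq> x + int k * m})"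
    using f g by (intro finite_vimageI bij_is_inj)
  ultimately have "finite {x. (f \<circ> g) x \<noteq> x + int k * (m + n)}"
    by (rule finite_subset[OF _ finite_UnI[OF g(2)]])
  moreover have "bij (f \<circ> g)" using f g by (intro bij_comp)
  ultimately show "f \<circ> g \<in> eventual_translations k"
    unfolding eventual_translations_def by blast
next
  fix f assume "f \<in> eventual_translations k"
  then obtain n where f: "bij f" "finite {x. f x \<noteq> x + int k * n}"
    by (auto simp: eventual_translations_def)
  have "{x. inv_into UNIV f x \<noteq> x + int k * (- n)} \<subseteq> f ` {x. f x \<noteq> x + int k * n}"
  proof
    fix x assume "x \<in> {x. inv_into UNIV f x \<noteq> x + int k * (- n)}"
    moreover have "f (inv_into UNIV f x) = x" using f by (simp add: bij_is_surj surj_f_inv_f)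
    ultimately show "x \<in> f ` {x. f x \<noteq> x + int k * n}"
      by (intro image_eqI[of _ _ "inv_into UNIV f x"]) auto
  qed
  then have "finite {x. inv_into UNIV f x \<noteq> x + int k * (- n)}"
    by (rule finite_subset[OF _ finite_imageI[OF f(2)]])
  then show "inv_into UNIV f \<in> eventual_translations k"
    using bij_imp_bij_inv[OF f(1)] unfolding eventual_translations_def by blast
qed (auto simp: eventual_translations_def)

lemma Gk_subset_eventual_translations: "carrier (Gk k) \<subseteq> eventual_translations k"
proof (rule carrier_Gk_subset[OF subgroup_eventual_translations])
  show "AltZ \<subseteq> eventual_translations k"
    by (auto simp: eventual_translations_def AltZ_iff permutation intro!: exI[of _ 0])
  have "bij (\<lambda>x. x + int k)"
    using subgroup_SymZ_bij[OF subgroup_Gk transl_in_Gk] .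
  then show "(\<lambda>x. x + int k) \<in> eventual_translations k"
    by (auto simp: eventual_translations_def intro!: exI[of _ 1])
qed

abbreviation iterate :: "(int \<Rightarrow> int) \<Rightarrow> int \<Rightarrow> int \<Rightarrow> int" where
  "iterate h m \<equiv> h [^]\<^bsub>SymZ\<^esub> m"

lemma iterate_add: "bij h \<Longrightarrow> iterate h (m + n) x = iterate h m (iterate h n x)"
  using group.int_pow_mult[OF group_SymZ, of h n m] by (simp add: SymZ_def add.commute)

lemma iterate_0: "iterate h 0 x = x"
  by (simp add: int_pow_def2) (simp add: nat_pow_def SymZ_def)

lemma iterate_1: "bij h \<Longrightarrow> iterate h 1 = h"
  using group.int_pow_1[OF group_SymZ, of h] by (simp add: SymZ_def)

text \<open>Far out in the direction of \<open>d\<close> the permutation \<open>h\<close> is the translation by \<open>d\<close>, so there it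
  keeps residues modulo \<open>d\<close> apart; at least three infinite orbits are therefore different.\<close>

lemma three_infinite_orbits:
  assumes h: "bij h" and fin: "finite {x. h x \<noteq> x + d}" and d: "\<bar>d\<bar> \<ge> 3"
  obtains N :: "int \<Rightarrow> int" where
    "\<And>i j m. i \<in> {0, 1, 2} \<Longrightarrow> j \<in> {0, 1, 2} \<Longrightarrow> iterate h m (N i) = N j \<Longrightarrow> i = j \<and> m = 0"
proof -
  obtain B where B: "\<And>x. h x \<noteq> x + d \<Longrightarrow> \<bar>x\<bar> \<le> B"
    using fin finite_imageI[OF fin, of abs] Max_ge[of "abs ` {x. h x \<noteq> x + d}"] by blast
  define M where "M = max B 0 + 1"
  \<comment> \<open>Points beyond every exception, counted in the direction of \<open>d\<close>; the case \<open>d < 0\<close> is thus included.\<close>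
  define N where "N i = sgn d * (M + i)" for i
  have step: "iterate h (int n) (N i) = N (i + \<bar>d\<bar> * int n)" if "i \<ge> 0" for i n
  proof (induction n)
    case 0
    then show ?case using iterate_0[of h] by simp
  next
    case (Suc n)
    let ?y = "N (i + \<bar>d\<bar> * int n)"
    have "0 \<le> i + \<bar>d\<bar> * int n" using that by simp
    then have "M + (i + \<bar>d\<bar> * int n) > B" "M + (i + \<bar>d\<bar> * int n) \<ge> 0"
      unfolding M_def by linarith+
    moreover have "d \<noteq> 0" using d by auto
    ultimately have "\<bar>?y\<bar> > B" by (simp add: N_def abs_mult)
    then have "h ?y = ?y + d" using B by fastforce
    also have "\<dots> = N (i + \<bar>d\<bar> * int (Suc n))"
      using mult_sgn_abs[of d] by (simp add: N_def algebra_simps)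
    finally show ?case
      using Suc iterate_add[OF h, of 1 "int n" "N i"] iterate_1[OF h] by (simp add: add.commute)
  qed
  have inj: "N i = N j \<longleftrightarrow> i = j" for i j
    using d by (auto simp: N_def sgn_eq_0_iff)
  have pos: "i = j \<and> n = 0"
    if "i \<in> {0, 1, 2}" "j \<in> {0, 1, 2}" "iterate h (int n) (N i) = N j" for i j n
  proof -
    have e: "i + \<bar>d\<bar> * int n = j" using step[of i n] that inj by auto
    have "n = 0"
    proof (rule ccontr)
      assume "n \<noteq> 0"
      then have "\<bar>d\<bar> * int n \<ge> \<bar>d\<bar> * 1" by (intro mult_left_mono) auto
      then show False using e that d by auto
    qed
    then show ?thesis using e by simp
  qed
  show thesis
  proof (rule that[of N])
    fix i j m assume ij: "i \<in> {0::int, 1, 2}" "j \<in> {0::int, 1, 2}" and e: "iterate h m (N i) = N j"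
    show "i = j \<and> m = 0"
    proof (cases "m \<ge> 0")
      case True
      then show ?thesis using pos[OF ij, of "nat m"] e by simp
    next
      case False
      have "iterate h (- m) (N j) = N i"
        using iterate_add[OF h, of "- m" m "N i"] e iterate_0 by (metis add.left_inverse)
      then show ?thesis using pos[OF ij(2,1), of "nat (- m)"] False by simp
    qed
  qed
qed

text \<open>Three points that meet every orbit of \<open>h\<close> meet each of the three infinite orbits once, and there
  is no room for any other coincidence.\<close>

lemma orbit_level_unique:
  assumes h: "bij h" and fin: "finite {x. h x \<noteq> x + d}" and d: "\<bar>d\<bar> \<ge> 3"
    and cover: "\<And>z. \<exists>m. z \<in> iterate h m ` {0, 1, 2}"
    and pq: "p \<in> {0, 1, 2}" "q \<in> {0, 1, 2}" "iterate h m p = iterate h n q"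
  shows "m = n"
proof -
  obtain N :: "int \<Rightarrow> int" where N:
    "\<And>i j m. i \<in> {0, 1, 2} \<Longrightarrow> j \<in> {0, 1, 2} \<Longrightarrow> iterate h m (N i) = N j \<Longrightarrow> i = j \<and> m = 0"
    using three_infinite_orbits[OF h fin d] by blast
  have "\<forall>i. \<exists>m r. r \<in> {0, 1, 2} \<and> N i = iterate h m r"
    using cover by blast
  then obtain l r where lr: "\<And>i. r i \<in> {0, 1, 2}" "\<And>i. N i = iterate h (l i) (r i)"
    by metis
  have base_point: "iterate h (- l i) (N i) = r i" for i
    using iterate_add[OF h, of "- l i" "l i" "r i"] lr(2)[of i] iterate_0 by (metis add.left_inverse)
  have "inj_on r {0, 1, 2}"
  proof (rule inj_onI)
    fix i j assume ij: "i \<in> {0::int, 1, 2}" "j \<in> {0::int, 1, 2}" "r i = r j"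
    have "iterate h (l j + - l i) (N i) = N j"
      unfolding iterate_add[OF h] base_point ij(3) by (rule lr(2)[symmetric])
    then show "i = j" using N ij by blast
  qed
  then have "r ` {0, 1, 2} = {0, 1, 2}"
    using lr(1) by (intro endo_inj_surj) auto
  then have "p \<in> r ` {0, 1, 2}" "q \<in> r ` {0, 1, 2}" using pq by simp_all
  then obtain i j where ij: "i \<in> {0, 1, 2}" "j \<in> {0, 1, 2}" "p = r i" "q = r j"
    by blast
  have "iterate h (m + - l i) (N i) = iterate h (n + - l j) (N j)"
    unfolding iterate_add[OF h] base_point using pq(3) ij(3,4) by simp
  then have "iterate h (- (n + - l j) + (m + - l i)) (N i) = N j"
    using iterate_add[OF h, of "- (n + - l j)" "m + - l i" "N i"]
      iterate_add[OF h, of "- (n + - l j)" "n + - l j" "N j"] iterate_0 by (metis add.left_inverse)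
  from N[OF ij(1,2) this] show "m = n" by auto
qed

lemma preserved_if_generators_preserve:
  assumes gen: "generate SymZ {g, h} = carrier (Gk k)" and "bij g" "bij h"
    and "\<And>x y. R (g x) (g y) \<longleftrightarrow> R x y" "\<And>x y. R (h x) (h y) \<longleftrightarrow> R x y"
    and "f \<in> AltZ"
  shows "R (f x) (f y) \<longleftrightarrow> R x y"
proof -
  have "generate SymZ {g, h} \<subseteq> {f. bij f \<and> (\<forall>x y. R (f x) (f y) \<longleftrightarrow> R x y)}"
    using assms
    by (intro group.generate_subgroup_incl[OF group_SymZ _ subgroup_relation_stabilizer]) auto
  then show ?thesis using assms AltZ_subset_Gk by blast
qed

text \<open>If the three-cycle on \<open>{0, 1, 2}\<close> and \<open>h\<close> generated the group, then every orbit of \<open>h\<close> would meet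
  \<open>{0, 1, 2}\<close>, because the orbits that do form an invariant set. The images of \<open>{0, 1, 2}\<close> under the
  powers of \<open>h\<close> are then disjoint, so that they are the blocks of an invariant partition, which the
  alternating group does not admit.\<close>

lemma cyc3_has_no_mate:
  assumes k: "k \<ge> 3" and hG: "h \<in> carrier (Gk k)"
  shows "generate SymZ {cyc3 0 1 2, h} \<noteq> carrier (Gk k)"
proof
  let ?g = "cyc3 0 1 2"
  assume gen: "generate SymZ {?g, h} = carrier (Gk k)"
  obtain n where h: "bij h" and fin: "finite {x. h x \<noteq> x + int k * n}"
    using hG Gk_subset_eventual_translations by (auto simp: eventual_translations_def)
  have g: "?g x = (if x = 0 then 1 else if x = 1 then 2 else if x = 2 then 0 else x)" for x
    by (simp add: cyc3_apply)
  \<comment> \<open>Finitary permutations generate only finitary permutations.\<close>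
  have "n \<noteq> 0"
  proof
    assume "n = 0"
    have "?g \<in> AltZ" by (rule cyc3_in_AltZ) simp
    then have "?g \<in> eventual_translations 0"
      by (rule subsetD[OF subset_trans[OF AltZ_subset_Gk Gk_subset_eventual_translations]])
    moreover have "h \<in> eventual_translations 0"
      using fin h \<open>n = 0\<close> by (simp add: eventual_translations_def)
    ultimately have "carrier (Gk k) \<subseteq> eventual_translations 0"
      unfolding gen[symmetric]
      by (intro group.generate_subgroup_incl[OF group_SymZ _ subgroup_eventual_translations]) simp
    then have "(\<lambda>x. x + int k) \<in> eventual_translations 0"
      by (rule subsetD[OF _ transl_in_Gk])
    then show False using k infinite_UNIV_int by (simp add: eventual_translations_def)
  qed
  then have d: "\<bar>int k * n\<bar> \<ge> 3"
    using k mult_mono[of 3 "int k" 1 "\<bar>n\<bar>"] by (simp add: abs_mult)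
  note preserved = preserved_if_generators_preserve[OF gen bij_cyc3 h]
  have shift: "h (iterate h m x) = iterate h (m + 1) x" for m x
    using iterate_add[OF h, of 1 m x] iterate_1[OF h] by (simp add: add.commute)
  define U where "U = (\<Union>m. iterate h m ` {0, 1, 2})"
  have base: "{0, 1, 2} \<subseteq> U"
    unfolding U_def using iterate_0 by (intro subsetI UN_I[of 0] image_eqI) auto
  have gU: "?g x \<in> U \<longleftrightarrow> x \<in> U" for x
    using base by (auto simp: g)
  have hU: "h x \<in> U \<longleftrightarrow> x \<in> U" for x
  proof
    assume "x \<in> U"
    then show "h x \<in> U" unfolding U_def using shift by blast
  next
    assume "h x \<in> U"
    then obtain m p where p: "p \<in> {0, 1, 2}" "h x = iterate h m p" unfolding U_def by blast
    then have "h x = h (iterate h (m - 1) p)" by (simp add: shift)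
    then have "x = iterate h (m - 1) p" using h by (simp add: bij_is_inj inj_eq)
    then show "x \<in> U" using p unfolding U_def by blast
  qed
  have U01: "0 \<in> U" "1 \<in> U" using base by auto
  have all_U: "z \<in> U" for z
  proof (cases "z = 1")
    case False
    have "(f x \<in> U \<longleftrightarrow> f y \<in> U) \<longleftrightarrow> (x \<in> U \<longleftrightarrow> y \<in> U)" if "f \<in> AltZ" for f x y
      by (rule preserved[of "\<lambda>x y. x \<in> U \<longleftrightarrow> y \<in> U"]) (simp_all only: gU hU that)
    then have "z \<in> U \<longleftrightarrow> 1 \<in> U"
      by (rule relation_spreads_if_AltZ_preserves[of "\<lambda>x y. x \<in> U \<longleftrightarrow> y \<in> U" 0 1 z])
        (use U01 False in simp_all)
    then show ?thesis using U01 by simp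
  qed (use U01 in simp)
  have cover: "\<exists>m. z \<in> iterate h m ` {0, 1, 2}" for z
    using all_U[of z] unfolding U_def by (simp only: UN_iff) blast
  \<comment> \<open>The block that contains \<open>z\<close> is the image of \<open>{0, 1, 2}\<close> under the power \<open>l z\<close> of \<open>h\<close>.\<close>
  define l where "l z = (SOME m. z \<in> iterate h m ` {0, 1, 2})" for z
  have l: "z \<in> iterate h (l z) ` {0, 1, 2}" for z
    unfolding l_def using cover by (rule someI_ex)
  have level: "l z = m" if "z \<in> iterate h m ` {0, 1, 2}" for z m
  proof -
    from l[of z] obtain p where p: "z = iterate h (l z) p" "p \<in> {0, 1, 2}" by (rule imageE)
    from that obtain q where q: "z = iterate h m q" "q \<in> {0, 1, 2}" by (rule imageE)
    show ?thesis
      by (rule orbit_level_unique[OF h fin d cover p(2) q(2)], rule trans[OF p(1)[symmetric] q(1)])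
  qed
  have l0: "l p = 0" if "p \<in> {0, 1, 2}" for p
    by (rule level, rule image_eqI[OF iterate_0[symmetric] that])
  have lh: "l (h z) = l z + 1" for z
  proof -
    from l[of z] obtain p where p: "z = iterate h (l z) p" "p \<in> {0, 1, 2}" by (rule imageE)
    have "h z = iterate h (l z + 1) p" using shift[of "l z" p] unfolding p(1)[symmetric] .
    then show ?thesis by (rule level[OF image_eqI[OF _ p(2)]])
  qed
  have lg: "l (?g z) = l z" for z
    unfolding g by (simp add: l0)
  have blocks: "l (f x) = l (f y) \<longleftrightarrow> l x = l y" if "f \<in> AltZ" for f x y
    by (rule preserved[of "\<lambda>x y. l x = l y"]) (simp_all add: lg lh that del: o_apply)
  have "h 0 \<noteq> 1" using lh[of 0] l0[of 0] l0[of 1] by auto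
  then have "l (h 0) = l 1"
    using relation_spreads_if_AltZ_preserves[of "\<lambda>x y. l x = l y" 0 1 "h 0", OF blocks]
    by (simp add: l0)
  then show False using l0 lh by simp
qed

theorem theorem4p1:
  shows "(\<forall>k\<ge>1. two_generated (Gk k)) \<and>
    (\<forall>k\<ge>1. \<forall>N. N \<lhd> Gk k \<and> N \<noteq> {\<one>\<^bsub>Gk k\<^esub>} \<longrightarrow> cyclic_group (Gk k Mod N)) \<and>
    (\<forall>k\<ge>3. \<not> three_halves_generated (Gk k) \<and> spread (Gk k) = 0)"
proof (intro conjI allI impI)
  fix k :: nat assume k: "k \<ge> 3"
  let ?g = "cyc3 0 1 2"
  have gG: "?g \<in> carrier (Gk k)"
    using cyc3_in_AltZ[of 0 1 2] AltZ_subset_Gk by auto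
  have "?g 0 \<noteq> id 0" by (simp add: cyc3_apply)
  then have g: "?g \<in> carrier (Gk k) - {\<one>\<^bsub>Gk k\<^esub>}"
    unfolding one_Gk using gG by (intro DiffI) auto
  have no_mate: "generate (Gk k) {?g, h} \<noteq> carrier (Gk k)" if "h \<in> carrier (Gk k)" for h
    using cyc3_has_no_mate[OF k that] generate_Gk[of "{?g, h}" k] that gG by simp
  then show "\<not> three_halves_generated (Gk k)"
    unfolding three_halves_generated_def using g by blast
  have spread_set: "j = 0" if j: "\<forall>g \<in> {1..j} \<rightarrow> carrier (Gk k) - {\<one>\<^bsub>Gk k\<^esub>}.
       \<exists>h\<in>carrier (Gk k). \<forall>i\<in>{1..j}. generate (Gk k) {g i, h} = carrier (Gk k)" for j :: nat
  proof (rule ccontr)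
    assume "j \<noteq> 0"
    have "(\<lambda>_. ?g) \<in> {1..j} \<rightarrow> carrier (Gk k) - {\<one>\<^bsub>Gk k\<^esub>}" using g by simp
    from bspec[OF j this] obtain h where h: "h \<in> carrier (Gk k)"
      and all: "\<forall>i\<in>{1..j}. generate (Gk k) {?g, h} = carrier (Gk k)" by (rule bexE)
    have "1 \<in> {1..j}" using \<open>j \<noteq> 0\<close> by simp
    from bspec[OF all this] show False using no_mate[OF h] by simp
  qed
  have "spread (Gk k) \<le> 0"
    unfolding spread_def
    by (rule Sup_least, elim CollectE exE conjE, drule spread_set) (simp add: zero_enat_def)
  then show "spread (Gk k) = 0" by simp
qed (use two_generated_Gk cyclic_quotient_Gk in simp_all)

end
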